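(* The flip-bias threshold $\kappa^*(n)$ of the Maker--Breaker directed triangle game on the parity tournament $\Pi(n)$ satisfies $$\kappa^*(n)\le \frac{n^2-1}{8}\ \text{ if } n \text{ is odd},\qquad \kappa^*(n)\le \frac{n^2}{8}+\frac n4-1\ \text{ if } n\text{ is even}.$$ Furthermore, if $n$ is odd and $n\ge 11$, then $\kappa^*(n)\ge \dfrac{n(n-11)}{12}$, and if $n$ is even and $n\ge 14$, then $\kappa^*(n)\ge \dfrac{n(n-14)}{12}+1$.
   Context: Let $V_n=\{1,2,\ldots,n\}$, and let $(i,j)$ denote the directed edge from $i$ to $j$. A tournament on $V_n$ is a directed graph containing, for all distinct $i,j\in V_n$, precisely one of $(i,j)$ and $(j,i)$, with no loops or parallel edges. Parity tournament $\Pi(n)$: the tournament on $V_n$ in which, for $i<j$, the edge is $(i,j)$ if $i+j$ is odd, and is $(j,i)$ if $i+j$ is even. A directed triangle $(i,j,k)$ in a tournament $T$ consists of three distinct vertices $i,j,k$ with $(i,j),(j,k),(k,i)\in E(T)$. Maker--Breaker directed triangle game on a tournament $T$ (unbiased): the board is the edge set $E(T)$. Maker moves first; the two players alternate, Maker claiming one previously untaken edge in each of her turns and Breaker claiming (deleting) one previously untaken edge in each of hers, until all edges are exhausted. Maker wins if at the end she has claimed all three edges of some directed triangle of $T$; otherwise Breaker wins. Flip-bias: for a set $S$ of unordered pairs $\{i,j\}$ with $1\le i<j\le n$, let $\Pi(n)_S$ be the tournament obtained from $\Pi(n)$ by reversing the orientation of the edge between $i$ and $j$ for each $\{i,j\}\in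 S$. The flip-bias threshold $\kappa^*(n)$ is the least integer $k\ge 0$ for which there is a set $S$ with $|S|\le k$ such that Breaker has a winning strategy in the unbiased Maker--Breaker directed triangle game on $\Pi(n)_S$. *)

theory Defs
  imports Complex_Main
begin

definition tournament_on :: "'a set \<Rightarrow> ('a \<times> 'a) set \<Rightarrow> bool" where
  "tournament_on V E \<longleftrightarrow>
     E \<subseteq> V \<times> V \<and> (\<forall>i. (i, i) \<notin> E) \<and>
     (\<forall>i\<in>V. \<forall>j\<in>V. i \<noteq> j \<longrightarrow> ((i, j) \<in> E \<longleftrightarrow> (j, i) \<notin> E))"

definition parity_tournament :: "nat \<Rightarrow> (nat \<times> nat) set" where
  "parity_tournament n =
     {(i, j). i \<in> {1..n} \<and> j \<in> {1..n} \<and> i < j \<and> odd (i + j)} \<union>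
     {(j, i) | i j. i \<in> {1..n} \<and> j \<in> {1..n} \<and> i < j \<and> even (i + j)}"

definition vertex_pairs :: "nat \<Rightarrow> nat set set" where
  "vertex_pairs n = {{i, j} | i j. 1 \<le> i \<and> i < j \<and> j \<le> n}"

definition flip :: "('a \<times> 'a) set \<Rightarrow> 'a set set \<Rightarrow> ('a \<times> 'a) set" where
  "flip E S = {(i, j). (i, j) \<in> E \<and> {i, j} \<notin> S} \<union> {(j, i) | i j. (i, j) \<in> E \<and> {i, j} \<in> S}"

definition directed_triangles :: "('a \<times> 'a) set \<Rightarrow> ('a \<times> 'a) set set" where
  "directed_triangles E =
     {{(i, j), (j, k), (k, i)} | i j k.
        i \<noteq> j \<and> j \<noteq> k \<and> i \<noteq> k \<and> (i, j) \<in> E \<and> (j, k) \<in> E \<and> (k, i) \<in> E}"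

text \<open>
  A (partial) play of a Maker-Breaker game on a board \<open>X\<close> is the list of the elements claimed so
  far, in chronological order.  Maker moves first, so the entries with even index are hers and
  those with odd index are Breaker's.  A strategy of Breaker maps the play so far to his next move.
\<close>

definition legal_play :: "'e set \<Rightarrow> 'e list \<Rightarrow> bool" where
  "legal_play X h \<longleftrightarrow> distinct h \<and> set h \<subseteq> X"

definition maker_claims :: "'e list \<Rightarrow> 'e set" where
  "maker_claims h = {h ! i | i. i < length h \<and> even i}"

definition breaker_follows :: "('e list \<Rightarrow> 'e) \<Rightarrow> 'e list \<Rightarrow> bool" where
  "breaker_follows \<sigma> h \<longleftrightarrow> (\<forall>i < length h. odd i \<longrightarrow> h ! i = \<sigma> (take i h))"

text \<open>
  The first conjunct makes the strategy prescribe a legal move whenever Breaker is to move;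
  without it, a strategy prescribing illegal moves would win vacuously.
\<close>

definition breaker_winning_strategy :: "'e set \<Rightarrow> 'e set set \<Rightarrow> ('e list \<Rightarrow> 'e) \<Rightarrow> bool" where
  "breaker_winning_strategy X F \<sigma> \<longleftrightarrow>
     (\<forall>h. legal_play X h \<and> breaker_follows \<sigma> h \<and> odd (length h) \<and> set h \<noteq> X
            \<longrightarrow> \<sigma> h \<in> X - set h) \<and>
     (\<forall>h. legal_play X h \<and> breaker_follows \<sigma> h \<and> set h = X
            \<longrightarrow> \<not> (\<exists>A\<in>F. A \<subseteq> maker_claims h))"

definition breaker_wins_triangle_game :: "('a \<times> 'a) set \<Rightarrow> bool" where
  "breaker_wins_triangle_game E \<longleftrightarrow>
     (\<exists>\<sigma>. breaker_winning_strategy E (directed_triangles E) \<sigma>)"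

definition flip_bias_threshold :: "nat \<Rightarrow> nat" where
  "flip_bias_threshold n =
     (LEAST k. \<exists>S. S \<subseteq> vertex_pairs n \<and> card S \<le> k \<and>
                   breaker_wins_triangle_game (flip (parity_tournament n) S))"

lemma mem_parity_tournament_iff:
  "(i, j) \<in> parity_tournament n \<longleftrightarrow>
     i \<in> {1..n} \<and> j \<in> {1..n} \<and> (i < j \<and> odd (i + j) \<or> j < i \<and> even (i + j))"
  using add.commute[of i j] unfolding parity_tournament_def by auto

lemma mem_flip_iff:
  "(i, j) \<in> flip E S \<longleftrightarrow> (if {i, j} \<in> S then (j, i) \<in> E else (i, j) \<in> E)"
  using insert_commute[of i j "{}"] unfolding flip_def by auto

lemma tournament_on_parity_tournament: "tournament_on {1..n} (parity_tournament n)"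
proof -
  have "(i, j) \<in> parity_tournament n \<longleftrightarrow> (j, i) \<notin> parity_tournament n"
    if "i \<in> {1..n}" "j \<in> {1..n}" "i \<noteq> j" for i j
    using that unfolding mem_parity_tournament_iff add.commute[of j i] by linarith
  then show ?thesis
    unfolding tournament_on_def by (auto simp: mem_parity_tournament_iff)
qed

lemma tournament_on_flip:
  assumes "tournament_on V E"
  shows "tournament_on V (flip E S)"
proof -
  have E: "E \<subseteq> V \<times> V" "\<And>i. (i, i) \<notin> E"
    "\<And>i j. i \<in> V \<Longrightarrow> j \<in> V \<Longrightarrow> i \<noteq> j \<Longrightarrow> (i, j) \<in> E \<longleftrightarrow> (j, i) \<notin> E"
    using assms unfolding tournament_on_def by blast+
  have "flip E S \<subseteq> V \<times> V"
    using E(1) unfolding flip_def by blast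
  moreover have "(i, i) \<notin> flip E S" for i
    using E(2) by (simp add: mem_flip_iff)
  moreover have "(i, j) \<in> flip E S \<longleftrightarrow> (j, i) \<notin> flip E S" if "i \<in> V" "j \<in> V" "i \<noteq> j" for i j
    using E(3)[OF that] unfolding mem_flip_iff insert_commute[of j i "{}"] by simp
  ultimately show ?thesis
    unfolding tournament_on_def by blast
qed

text \<open>
  The minimum defining the threshold exists: reversing all edges \<open>(i, j)\<close> with \<open>i > j\<close> leaves a
  transitive tournament, on which Breaker wins with any legal moves.
\<close>

lemma flip_bias_threshold_exists:
  "\<exists>k S. S \<subseteq> vertex_pairs n \<and> card S \<le> k \<and>
         breaker_wins_triangle_game (flip (parity_tournament n) S)"
proof -
  define S where "S = {{i, j} | i j. 1 \<le> i \<and> i < j \<and> j \<le> n \<and> even (i + j)}"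
  define E where "E = flip (parity_tournament n) S"
  have S: "{i, j} \<in> S \<longleftrightarrow>
      i \<in> {1..n} \<and> j \<in> {1..n} \<and> i \<noteq> j \<and> even (i + j)" for i j
  proof
    assume "{i, j} \<in> S"
    then obtain k l where "{i, j} = {k, l}" "1 \<le> k" "k < l" "l \<le> n" "even (k + l)"
      unfolding S_def by blast
    then show "i \<in> {1..n} \<and> j \<in> {1..n} \<and> i \<noteq> j \<and> even (i + j)"
      by (auto simp: doubleton_eq_iff)
  next
    assume *: "i \<in> {1..n} \<and> j \<in> {1..n} \<and> i \<noteq> j \<and> even (i + j)"
    show "{i, j} \<in> S"
    proof (cases "i < j")
      case True
      with * show ?thesis unfolding S_def by auto
    next
      case False
      with * have "1 \<le> j" "j < i" "i \<le> n" "even (j + i)" by auto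
      then have "{j, i} \<in> S" unfolding S_def by blast
      then show ?thesis by (simp only: insert_commute[of i j "{}"])
    qed
  qed
  have up: "i < j" if "(i, j) \<in> E" for i j
    using that unfolding E_def mem_flip_iff S mem_parity_tournament_iff
    by (simp split: if_splits) linarith?
  have "directed_triangles E = {}"
    unfolding directed_triangles_def using up by (blast dest: less_trans less_asym)
  moreover have "(SOME e. e \<in> E - set h) \<in> E - set h" if "legal_play E h" "set h \<noteq> E" for h
    by (rule someI_ex) (use that in \<open>auto simp: legal_play_def\<close>)
  ultimately have "breaker_winning_strategy E (directed_triangles E) (\<lambda>h. SOME e. e \<in> E - set h)"
    unfolding breaker_winning_strategy_def by blast
  then have "breaker_wins_triangle_game (flip (parity_tournament n) S)"
    unfolding breaker_wins_triangle_game_def E_def by blast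
  moreover have "S \<subseteq> vertex_pairs n"
    unfolding S_def vertex_pairs_def by blast
  ultimately show ?thesis by blast
qed

end

theory Submission
  imports Defs
begin

text \<open>
  Upper bounds: reversing the edges between an even \<open>i\<close> and an odd \<open>j > i\<close> makes the
  tournament transitive, since all edges then go from odd to even vertices or downwards within a
  parity class.  (For odd \<open>n\<close> this is the cyclic order in which the parity tournament is
  rotational.)

  Lower bounds: two edges lie in at most one directed triangle, so Beck's criterion for Maker's win
  shows that a tournament on which Breaker wins has at most as many directed triangles as edges.
  The number of triangles is \<open>n (n\<^sup>2 - 1) / 24\<close> minus one eighth of the sum of the squares of the
  excesses, where the excess of a vertex is its outdegree minus its indegree.  In the parity
  tournament the excesses are at most 1 in absolute value; a flip changes two of them, by 2 each,
  and no excess exceeds \<open>n - 1\<close>, so few flips leave too many triangles.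
\<close>

section \<open>Beck's criterion for Maker's win\<close>

lemma maker_claims_snoc:
  "maker_claims (h @ [x]) = (if even (length h) then insert x (maker_claims h) else maker_claims h)"
proof -
  have "maker_claims (h @ [x]) =
      {(h @ [x]) ! i | i. i < length h \<and> even i} \<union> (if even (length h) then {x} else {})"
    unfolding maker_claims_def by (auto simp: less_Suc_eq intro: exI[of _ "length h"])
  also have "{(h @ [x]) ! i | i. i < length h \<and> even i} = maker_claims h"
    unfolding maker_claims_def by (force simp: nth_append)
  finally show ?thesis by simp
qed

lemma maker_claims_subset: "maker_claims h \<subseteq> set h"
  unfolding maker_claims_def by auto

text \<open>A set is live if Breaker has claimed none of its elements.\<close>

definition live_sets :: "'e set set \<Rightarrow> 'e list \<Rightarrow> 'e set set" where
  "live_sets F h = {A \<in> F. A \<inter> set h \<subseteq> maker_claims h}"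

text \<open>The Erdos-Selfridge potential: the expected number of live sets that Maker would
  complete if every unclaimed element went to her independently with probability 1/2.\<close>

definition potential :: "'e set set \<Rightarrow> 'e list \<Rightarrow> real" where
  "potential F h = (\<Sum>A\<in>live_sets F h. (1/2) ^ card (A - set h))"

text \<open>For an unclaimed \<open>x\<close>, this is both the gain in potential if Maker takes
  \<open>x\<close> and the loss if Breaker does.\<close>

definition danger :: "'e set set \<Rightarrow> 'e list \<Rightarrow> 'e \<Rightarrow> real" where
  "danger F h x = (\<Sum>A | A \<in> live_sets F h \<and> x \<in> A. (1/2) ^ card (A - set h))"

section \<open>How a single move changes live sets, potential and danger\<close>

lemma finite_live_sets: "finite F \<Longrightarrow> finite (live_sets F h)"
  unfolding live_sets_def by simp

lemma live_sets_maker_move: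
  assumes "even (length h)" "x \<notin> set h"
  shows "live_sets F (h @ [x]) = live_sets F h"
  using assms maker_claims_subset[of h] unfolding live_sets_def maker_claims_snoc by auto

lemma live_sets_breaker_move:
  assumes "odd (length h)" "y \<notin> set h"
  shows "live_sets F (h @ [y]) = {A \<in> live_sets F h. y \<notin> A}"
  using assms maker_claims_subset[of h] unfolding live_sets_def maker_claims_snoc by auto

text \<open>Claiming \<open>x\<close> shortens the unclaimed part of a set through \<open>x\<close>
  by one and so doubles its weight. The doubling is written as a sum so that summing over live sets
  separates the old potential from the danger.\<close>

lemma half_power_card_claim:
  assumes "finite A" "x \<notin> set h"
  shows "(1/2 :: real) ^ card (A - set (h @ [x])) =
    (1/2) ^ card (A - set h) + (if x \<in> A then (1/2) ^ card (A - set h) else 0)"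
proof (cases "x \<in> A")
  case True
  have "A - set (h @ [x]) = A - set h - {x}" by auto
  with True have "card (A - set h) = Suc (card (A - set (h @ [x])))"
    using assms card.remove[of "A - set h" x] by (metis DiffI finite_Diff)
  with True show ?thesis by simp
next
  case False
  then have "A - set (h @ [x]) = A - set h" by auto
  with False show ?thesis by simp
qed

lemma potential_maker_move:
  assumes "finite F" "\<And>A. A \<in> F \<Longrightarrow> finite A" "even (length h)" "x \<notin> set h"
  shows "potential F (h @ [x]) = potential F h + danger F h x"
proof -
  have "potential F (h @ [x]) = (\<Sum>A\<in>live_sets F h.
      (1/2) ^ card (A - set h) + (if x \<in> A then (1/2) ^ card (A - set h) else 0))"
    unfolding potential_def live_sets_maker_move[OF assms(3,4)]
    using assms(2,4) by (intro sum.cong refl half_power_card_claim) (auto simp: live_sets_def)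
  also have "\<dots> = potential F h + danger F h x"
    unfolding sum.distrib potential_def danger_def
    using finite_live_sets[OF assms(1)] by (simp add: sum.inter_filter)
  finally show ?thesis .
qed

text \<open>Breaker's move kills the live sets through \<open>y\<close> and leaves the unclaimed
  part of every other live set unchanged.\<close>

lemma potential_breaker_move:
  assumes "finite F" "odd (length h)" "y \<notin> set h"
  shows "potential F (h @ [y]) = potential F h - danger F h y"
proof -
  have "potential F (h @ [y]) = (\<Sum>A | A \<in> live_sets F h \<and> y \<notin> A. (1/2) ^ card (A - set h))"
    unfolding potential_def live_sets_breaker_move[OF assms(2,3)]
    by (intro sum.cong refl arg_cong[where f = "\<lambda>B. (1/2) ^ card B"]) auto
  moreover have "potential F h =
      (\<Sum>A | A \<in> live_sets F h \<and> y \<notin> A. (1/2) ^ card (A - set h)) + danger F h y"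
    unfolding potential_def danger_def using finite_live_sets[OF assms(1), of h]
    by (subst sum.union_disjoint[symmetric]) (auto intro!: sum.cong)
  ultimately show ?thesis by simp
qed

text \<open>Only sets through both \<open>x\<close> and \<open>y\<close> gain weight. Each still has
  at least these two elements unclaimed, so its weight before the move, which is also its gain, is
  at most 1/4.\<close>

lemma danger_after_maker_move:
  assumes "finite F" "\<And>A. A \<in> F \<Longrightarrow> finite A" "even (length h)"
    and "x \<notin> set h" "y \<notin> set h" "x \<noteq> y"
    and "card {A \<in> F. x \<in> A \<and> y \<in> A} \<le> \<Delta>"
  shows "danger F (h @ [x]) y \<le> danger F h y + real \<Delta> / 4"
proof -
  let ?L = "{A. A \<in> live_sets F h \<and> y \<in> A}"
  have fin: "finite ?L" using finite_live_sets[OF assms(1)] by simp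
  have "danger F (h @ [x]) y = (\<Sum>A\<in>?L.
      (1/2) ^ card (A - set h) + (if x \<in> A then (1/2) ^ card (A - set h) else 0))"
    unfolding danger_def live_sets_maker_move[OF assms(3,4)]
    using assms(2,4) by (intro sum.cong refl half_power_card_claim) (auto simp: live_sets_def)
  also have "\<dots> = danger F h y + (\<Sum>A | A \<in> ?L \<and> x \<in> A. (1/2) ^ card (A - set h))"
    unfolding sum.distrib danger_def using fin by (subst sum.inter_filter) auto
  also have "(\<Sum>A | A \<in> ?L \<and> x \<in> A. (1/2 :: real) ^ card (A - set h)) \<le>
      (\<Sum>A | A \<in> ?L \<and> x \<in> A. 1/4)"
  proof (rule sum_mono)
    fix A assume A: "A \<in> {A. A \<in> ?L \<and> x \<in> A}"
    then have "{x, y} \<subseteq> A - set h" "finite A"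
      using assms by (auto simp: live_sets_def)
    then have "card {x, y} \<le> card (A - set h)" by (intro card_mono) auto
    then have "2 \<le> card (A - set h)" using assms(6) by simp
    then have "(1/2 :: real) ^ card (A - set h) \<le> (1/2) ^ 2"
      by (intro power_decreasing) auto
    then show "(1/2 :: real) ^ card (A - set h) \<le> 1/4" by (simp add: power2_eq_square)
  qed
  also have "\<dots> \<le> real \<Delta> / 4"
  proof -
    have "card {A. A \<in> ?L \<and> x \<in> A} \<le> card {A \<in> F. x \<in> A \<and> y \<in> A}"
      using assms(1) by (intro card_mono) (auto simp: live_sets_def)
    then show ?thesis using assms(7) by simp
  qed
  finally show ?thesis by simp
qed

lemma breaker_follows_maker_move:
  assumes "breaker_follows \<sigma> h" "even (length h)"
  shows "breaker_follows \<sigma> (h @ [x])"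
  using assms unfolding breaker_follows_def by (auto simp: nth_append less_Suc_eq)

lemma breaker_follows_breaker_move:
  assumes "breaker_follows \<sigma> h"
  shows "breaker_follows \<sigma> (h @ [\<sigma> h])"
  using assms unfolding breaker_follows_def by (auto simp: nth_append less_Suc_eq)

text \<open>Maker claims an element of maximal danger.  Breaker's reply is at most as dangerous beforehand,
  so the potential drops only by what her own move added to the danger of that reply.\<close>

lemma potential_le_of_breaker_wins:
  assumes "finite X" "F \<subseteq> Pow X"
    and win: "breaker_winning_strategy X F \<sigma>"
    and pair: "\<And>x y. x \<in> X \<Longrightarrow> y \<in> X \<Longrightarrow> x \<noteq> y \<Longrightarrow> card {A \<in> F. x \<in> A \<and> y \<in> A} \<le> \<Delta>"
    and "legal_play X h" "breaker_follows \<sigma> h" "even (length h)"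
  shows "potential F h \<le> real \<Delta> * real (card (X - set h)) / 8"
  using assms(5-)
proof (induction "card (X - set h)" arbitrary: h rule: less_induct)
  case less
  have finF: "finite F" using assms(1,2) by (meson finite_Pow_iff finite_subset)
  have finA: "\<And>A. A \<in> F \<Longrightarrow> finite A" using assms(1,2) finite_subset by blast
  \<comment> \<open>On a full board a live set would lie entirely within Maker's claims,
    contradicting that Breaker has won.\<close>
  have full: "potential F h = 0" if "legal_play X h" "breaker_follows \<sigma> h" "set h = X" for h
  proof -
    have "live_sets F h = {}"
      using win that assms(2) unfolding breaker_winning_strategy_def live_sets_def by blast
    then show ?thesis by (simp add: potential_def)
  qed
  have reply: "\<sigma> h \<in> X - set h"
    if "legal_play X h" "breaker_follows \<sigma> h" "odd (length h)" "set h \<noteq> X" for h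
    using win that unfolding breaker_winning_strategy_def by blast
  have danger_nonneg: "danger F h x \<ge> 0" for h x
    unfolding danger_def by (simp add: sum_nonneg)
  show ?case
  proof (cases "set h = X")
    case True
    then show ?thesis using full less.prems by simp
  next
    case False
    have "finite (X - set h)" "X - set h \<noteq> {}"
      using False less.prems(1) assms(1) unfolding legal_play_def by auto
    then have "Max (danger F h ` (X - set h)) \<in> danger F h ` (X - set h)"
      by (intro Max_in) auto
    then obtain x where x: "x \<in> X" "x \<notin> set h"
      and "danger F h x = Max (danger F h ` (X - set h))" by auto
    then have xmax: "danger F h y \<le> danger F h x" if "y \<in> X - set h" for y
      using that \<open>finite (X - set h)\<close> by simp
    have legal_x: "legal_play X (h @ [x])"
      using less.prems(1) x unfolding legal_play_def by auto
    have follows_x: "breaker_follows \<sigma> (h @ [x])"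
      using breaker_follows_maker_move[OF less.prems(2,3)] .
    have pot_x: "potential F (h @ [x]) = potential F h + danger F h x"
      using potential_maker_move[OF finF finA less.prems(3) x(2)] .
    show ?thesis
    proof (cases "set (h @ [x]) = X")
      \<comment> \<open>Maker has taken the last element of a board of odd size, so there is no
        reply; the potential ends at 0 and her move cannot have lowered it.\<close>
      case True
      have "potential F h \<le> 0"
        using full[OF legal_x follows_x True] pot_x danger_nonneg[of h x] by simp
      moreover have "0 \<le> real \<Delta> * real (card (X - set h)) / 8" by simp
      ultimately show ?thesis by linarith
    next
      case False
      define y where "y = \<sigma> (h @ [x])"
      have y: "y \<in> X - set (h @ [x])"
        unfolding y_def using less.prems(3) by (intro reply legal_x follows_x False) simp
      have pot_y: "potential F (h @ [x] @ [y]) = potential F (h @ [x]) - danger F (h @ [x]) y"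
        using potential_breaker_move[OF finF, of "h @ [x]" y] less.prems(3) y by simp
      have "danger F (h @ [x]) y \<le> danger F h y + real \<Delta> / 4"
        using danger_after_maker_move[OF finF finA less.prems(3) x(2), of y \<Delta>] pair[of x y] x y
        by auto
      moreover have "danger F h y \<le> danger F h x" using xmax y by auto
      ultimately have step: "potential F h \<le> potential F (h @ [x] @ [y]) + real \<Delta> / 4"
        using pot_x pot_y by linarith
      have "X - set (h @ [x] @ [y]) = X - set h - {x, y}" by auto
      moreover have "card (X - set h - {x, y}) = card (X - set h) - card {x, y}"
        using x y by (intro card_Diff_subset) auto
      moreover have "card {x, y} \<le> card (X - set h)"
        using x y assms(1) by (intro card_mono) auto
      moreover have "card {x, y} = 2"
        using y by auto
      ultimately have card: "card (X - set h) = card (X - set (h @ [x] @ [y])) + 2"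
        by (metis le_add_diff_inverse2)
      have "card (X - set (h @ [x] @ [y])) < card (X - set h)"
        using card by linarith
      moreover have "legal_play X (h @ [x] @ [y])"
        using legal_x y unfolding legal_play_def by auto
      moreover have "breaker_follows \<sigma> (h @ [x] @ [y])"
        using breaker_follows_breaker_move[OF follows_x] unfolding y_def by simp
      moreover have "even (length (h @ [x] @ [y]))"
        using less.prems(3) by simp
      ultimately have "potential F (h @ [x] @ [y]) \<le>
          real \<Delta> * real (card (X - set (h @ [x] @ [y]))) / 8"
        by (rule less.hyps)
      \<comment> \<open>A round consumes two elements and may cost \<open>\<Delta> / 4\<close> of
        potential, that is \<open>\<Delta> / 8\<close> per element; this is the origin of the 8 in
        the criterion.\<close>
      moreover have "real \<Delta> * real (card (X - set h)) / 8 =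
          real \<Delta> * real (card (X - set (h @ [x] @ [y]))) / 8 + real \<Delta> / 4"
        unfolding card of_nat_add distrib_left add_divide_distrib by simp
      ultimately show ?thesis using step by linarith
    qed
  qed
qed

text \<open>On the empty play every set is live with all its elements unclaimed, so the initial
  potential is the sum on the left. Read contrapositively: a larger sum rules out a winning strategy
  of Breaker.\<close>

theorem beck_maker_criterion:
  assumes "finite X" "F \<subseteq> Pow X" "breaker_winning_strategy X F \<sigma>"
    and "\<And>x y. x \<in> X \<Longrightarrow> y \<in> X \<Longrightarrow> x \<noteq> y \<Longrightarrow> card {A \<in> F. x \<in> A \<and> y \<in> A} \<le> \<Delta>"
  shows "(\<Sum>A\<in>F. (1/2) ^ card A) \<le> real \<Delta> * real (card X) / 8"
proof -
  have "potential F [] \<le> real \<Delta> * real (card (X - set [])) / 8"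
    by (rule potential_le_of_breaker_wins[OF assms])
       (auto simp: legal_play_def breaker_follows_def)
  then show ?thesis by (simp add: potential_def live_sets_def)
qed

section \<open>Counting directed triangles\<close>

text \<open>Two edges of a directed triangle are consecutive in one of the two orders, and the third
  edge closes the path that they form.\<close>

lemma directed_triangle_eq_of_two_edges:
  assumes "A \<in> directed_triangles E" "x \<in> A" "y \<in> A" "x \<noteq> y"
  shows "A = (if snd x = fst y then {x, y, (snd y, fst x)} else {x, y, (snd x, fst y)})"
  using assms unfolding directed_triangles_def by auto

text \<open>This supplies \<open>\<Delta> = 1\<close> in Beck's criterion.\<close>

lemma card_directed_triangles_two_edges:
  assumes "x \<noteq> y"
  shows "card {A \<in> directed_triangles E. x \<in> A \<and> y \<in> A} \<le> 1"
proof -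
  have "{A \<in> directed_triangles E. x \<in> A \<and> y \<in> A} \<subseteq>
      {if snd x = fst y then {x, y, (snd y, fst x)} else {x, y, (snd x, fst y)}}"
    using directed_triangle_eq_of_two_edges[OF _ _ _ assms] by blast
  then show ?thesis using card_mono[of "{_}"] by fastforce
qed

lemma card_directed_triangle: "A \<in> directed_triangles E \<Longrightarrow> card A = 3"
  unfolding directed_triangles_def by auto

lemma directed_triangles_subset: "directed_triangles E \<subseteq> Pow E"
  unfolding directed_triangles_def by auto

text \<open>Ordered triples, in which the three rotations of a triangle count separately, make the
  count a plain triple sum over vertices.\<close>

definition cyclic_triples :: "('a \<times> 'a) set \<Rightarrow> ('a \<times> 'a \<times> 'a) set" where
  "cyclic_triples E = {(a, b, c). (a, b) \<in> E \<and> (b, c) \<in> E \<and> (c, a) \<in> E}"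

text \<open>The map from a triple to its edge set has only the rotations of one triple in each
  fibre; asymmetry of \<open>E\<close> makes the three vertices distinct.\<close>

lemma card_cyclic_triples_le:
  assumes "finite E" "\<And>i j. (i, j) \<in> E \<Longrightarrow> (j, i) \<notin> E"
  shows "card (cyclic_triples E) \<le> 3 * card (directed_triangles E)"
proof -
  let ?g = "\<lambda>(a, b, c). {(a, b), (b, c), (c, a)}"
  let ?fib = "\<lambda>A. {t \<in> cyclic_triples E. ?g t = A}"
  have fin: "finite (directed_triangles E)"
    using directed_triangles_subset assms(1) by (meson finite_Pow_iff finite_subset)
  have "cyclic_triples E \<subseteq> (\<Union>A\<in>directed_triangles E. ?fib A)"
  proof
    fix t assume t: "t \<in> cyclic_triples E"
    obtain a b c where abc: "t = (a, b, c)" by (cases t)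
    with t have E: "(a, b) \<in> E" "(b, c) \<in> E" "(c, a) \<in> E" unfolding cyclic_triples_def by auto
    with assms(2) have "a \<noteq> b" "b \<noteq> c" "a \<noteq> c" by blast+
    with E have "?g t \<in> directed_triangles E" unfolding directed_triangles_def abc by auto
    with t show "t \<in> (\<Union>A\<in>directed_triangles E. ?fib A)" by blast
  qed
  moreover have fib: "finite (?fib A) \<and> card (?fib A) \<le> 3" if "A \<in> directed_triangles E" for A
  proof -
    obtain i j k where A: "A = {(i, j), (j, k), (k, i)}" and "i \<noteq> j" "j \<noteq> k" "i \<noteq> k"
      using \<open>A \<in> directed_triangles E\<close> unfolding directed_triangles_def by blast
    have sub: "?fib A \<subseteq> {(i, j, k), (j, k, i), (k, i, j)}"
    proof
      fix t assume "t \<in> ?fib A"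
      moreover obtain a b c where "t = (a, b, c)" by (cases t)
      ultimately have t: "t = (a, b, c)" "{(a, b), (b, c), (c, a)} = A" by auto
      \<comment> \<open>The first two edges fix the triple: once \<open>(a, b)\<close> is chosen in
        \<open>A\<close>, only one edge of \<open>A\<close> starts at \<open>b\<close>.\<close>
      then have "(a, b) \<in> A" "(b, c) \<in> A" by auto
      then show "t \<in> {(i, j, k), (j, k, i), (k, i, j)}"
        unfolding A t(1) using \<open>i \<noteq> j\<close> \<open>j \<noteq> k\<close> \<open>i \<noteq> k\<close> by auto
    qed
    have "card (?fib A) \<le> card {(i, j, k), (j, k, i), (k, i, j)}"
      by (rule card_mono[OF _ sub]) simp
    also have "\<dots> \<le> 3"
      using card_length[of "[(i, j, k), (j, k, i), (k, i, j)]"] by simp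
    finally show ?thesis using finite_subset[OF sub] by simp
  qed
  ultimately have "card (cyclic_triples E) \<le> card (\<Union>A\<in>directed_triangles E. ?fib A)"
    using fin by (intro card_mono finite_UN_I) auto
  also have "\<dots> \<le> (\<Sum>A\<in>directed_triangles E. card (?fib A))"
    using fin by (rule card_UN_le)
  also have "\<dots> \<le> (\<Sum>A\<in>directed_triangles E. 3)"
    using fib by (intro sum_mono) blast
  finally show ?thesis by simp
qed

section \<open>Degrees, excesses and the number of cyclic triples\<close>

definition edge_ind :: "('a \<times> 'a) set \<Rightarrow> 'a \<Rightarrow> 'a \<Rightarrow> int" where
  "edge_ind E i j = (if (i, j) \<in> E then 1 else 0)"

definition excess :: "'a set \<Rightarrow> ('a \<times> 'a) set \<Rightarrow> 'a \<Rightarrow> int" where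
  "excess V E v = (\<Sum>j\<in>V. edge_ind E v j - edge_ind E j v)"

definition outdegree :: "'a set \<Rightarrow> ('a \<times> 'a) set \<Rightarrow> 'a \<Rightarrow> int" where
  "outdegree V E v = (\<Sum>j\<in>V. edge_ind E v j)"

definition indegree :: "'a set \<Rightarrow> ('a \<times> 'a) set \<Rightarrow> 'a \<Rightarrow> int" where
  "indegree V E v = (\<Sum>j\<in>V. edge_ind E j v)"

lemma edge_ind_add:
  assumes "tournament_on V E" "i \<in> V" "j \<in> V"
  shows "edge_ind E i j + edge_ind E j i = (if i = j then 0 else 1)"
proof (cases "i = j")
  case True
  then show ?thesis using assms(1) by (simp add: tournament_on_def edge_ind_def)
next
  case False
  then have "(i, j) \<in> E \<longleftrightarrow> (j, i) \<notin> E"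
    using assms unfolding tournament_on_def by metis
  with False show ?thesis by (simp add: edge_ind_def)
qed

lemma outdegree_add_indegree:
  assumes "finite V" "tournament_on V E" "v \<in> V"
  shows "outdegree V E v + indegree V E v = int (card V) - 1"
proof -
  have "outdegree V E v + indegree V E v = (\<Sum>j\<in>V. if v = j then 0 else 1)"
    unfolding outdegree_def indegree_def sum.distrib[symmetric]
    using assms by (intro sum.cong refl edge_ind_add)
  also have "\<dots> = (\<Sum>j\<in>V. 1 - (if v = j then 1 else 0))"
    by (intro sum.cong) auto
  also have "\<dots> = int (card V) - 1"
    using assms by (simp add: sum_subtractf)
  finally show ?thesis .
qed

lemma excess_eq: "excess V E v = outdegree V E v - indegree V E v"
  unfolding excess_def outdegree_def indegree_def by (simp add: sum_subtractf)

lemma sum_outdegree_eq_indegree: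
  "(\<Sum>v\<in>V. outdegree V E v) = (\<Sum>v\<in>V. indegree V E v)"
  unfolding outdegree_def indegree_def by (rule sum.swap)

lemma card_eq_sum_edge_ind:
  assumes "finite V" "E \<subseteq> V \<times> V"
  shows "int (card E) = (\<Sum>v\<in>V. outdegree V E v)"
proof -
  have "int (card E) = (\<Sum>p\<in>E. 1)" by simp
  also have "\<dots> = (\<Sum>p\<in>V \<times> V. if p \<in> E then 1 else 0)"
    using assms by (subst sum.inter_restrict[symmetric]) (auto simp: Int_absorb1)
  finally show ?thesis
    unfolding outdegree_def edge_ind_def sum.cartesian_product by (simp add: case_prod_beta)
qed

lemma twice_card_tournament:
  assumes "finite V" "tournament_on V E"
  shows "2 * int (card E) = int (card V) * (int (card V) - 1)"
proof -
  have "2 * int (card E) = (\<Sum>v\<in>V. outdegree V E v + indegree V E v)"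
    using assms card_eq_sum_edge_ind[of V E]
    by (simp add: tournament_on_def sum.distrib sum_outdegree_eq_indegree)
  also have "\<dots> = (\<Sum>v\<in>V. int (card V) - 1)"
    using assms by (intro sum.cong refl outdegree_add_indegree)
  finally show ?thesis by simp
qed

lemma card_cyclic_triples_eq:
  assumes "finite V" "E \<subseteq> V \<times> V"
  shows "int (card (cyclic_triples E)) =
    (\<Sum>a\<in>V. \<Sum>b\<in>V. \<Sum>c\<in>V. edge_ind E a b * edge_ind E b c * edge_ind E c a)"
proof -
  have "int (card (cyclic_triples E)) = (\<Sum>p\<in>cyclic_triples E. 1)" by simp
  also have "\<dots> = (\<Sum>p\<in>V \<times> V \<times> V. if p \<in> cyclic_triples E then 1 else 0)"
    using assms
    by (subst sum.inter_restrict[symmetric]) (auto simp: cyclic_triples_def intro!: arg_cong[where f = card])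
  also have "\<dots> = (\<Sum>(a, b, c)\<in>V \<times> V \<times> V. edge_ind E a b * edge_ind E b c * edge_ind E c a)"
    by (intro sum.cong) (auto simp: cyclic_triples_def edge_ind_def split: if_splits)
  finally show ?thesis by (simp add: sum.cartesian_product)
qed

text \<open>Every path \<open>a \<rightarrow> b \<rightarrow> c\<close> closes either to a cyclic or to a transitive triple,
  and every transitive triple is counted twice among the pairs of out-neighbours of its source.\<close>

lemma cyclic_triples_outdegree:
  assumes "finite V" "tournament_on V E"
  shows "2 * int (card (cyclic_triples E)) =
    (\<Sum>v\<in>V. 2 * outdegree V E v * indegree V E v - (outdegree V E v)\<^sup>2 + outdegree V E v)"
proof -
  let ?e = "edge_ind E"
  \<comment> \<open>\<open>T\<close> counts transitive triples, listed as source, middle vertex and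
    sink.\<close>
  define T where "T = (\<Sum>a\<in>V. \<Sum>b\<in>V. \<Sum>c\<in>V. ?e a b * ?e b c * ?e a c)"
  \<comment> \<open>A nonzero product means a path from \<open>a\<close> through \<open>b\<close> to
    \<open>c\<close>; asymmetry excludes \<open>a = c\<close>, so exactly one edge joins its
    ends.\<close>
  have ee: "?e a c + ?e c a = 1" if "a \<in> V" "b \<in> V" "c \<in> V" "?e a b * ?e b c \<noteq> 0" for a b c
  proof -
    have "(a, b) \<in> E" "(b, c) \<in> E"
      using that(4) by (auto simp: edge_ind_def split: if_splits)
    then have "a \<noteq> c"
      using edge_ind_add[OF assms(2), of a b] that(1,2) by (auto simp: edge_ind_def split: if_splits)
    then show ?thesis
      using edge_ind_add[OF assms(2), of a c] that(1,3) by simp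
  qed
  \<comment> \<open>Paths of length two are grouped by their middle vertex.\<close>
  have "(\<Sum>v\<in>V. outdegree V E v * indegree V E v) = (\<Sum>v\<in>V. indegree V E v * outdegree V E v)"
    by (simp only: mult.commute)
  also have "\<dots> = (\<Sum>b\<in>V. \<Sum>a\<in>V. \<Sum>c\<in>V. ?e a b * ?e b c)"
    unfolding outdegree_def indegree_def sum_product ..
  also have "\<dots> = (\<Sum>a\<in>V. \<Sum>b\<in>V. \<Sum>c\<in>V. ?e a b * ?e b c)"
    by (rule sum.swap)
  also have "\<dots> = (\<Sum>a\<in>V. \<Sum>b\<in>V. \<Sum>c\<in>V. ?e a b * ?e b c * ?e a c + ?e a b * ?e b c * ?e c a)"
  proof (intro sum.cong refl)
    fix a b c assume "a \<in> V" "b \<in> V" "c \<in> V"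
    then show "?e a b * ?e b c = ?e a b * ?e b c * ?e a c + ?e a b * ?e b c * ?e c a"
      using ee[of a b c] 
      by (metis add.right_neutral distrib_left mult.right_neutral mult_zero_left)
  qed
  also have "\<dots> = T + int (card (cyclic_triples E))"
    using assms unfolding T_def
    by (subst card_cyclic_triples_eq[OF assms(1)]) (auto simp: tournament_on_def sum.distrib)
  finally have paths: "(\<Sum>v\<in>V. outdegree V E v * indegree V E v) = T + int (card (cyclic_triples E))" .
  \<comment> \<open>The square counts ordered pairs of out-neighbours: the diagonal
    \<open>b = c\<close> contributes the outdegree, and a pair \<open>b \<noteq> c\<close> is a
    transitive triple in one of the two orders.\<close>
  have "(\<Sum>v\<in>V. (outdegree V E v)\<^sup>2) = (\<Sum>a\<in>V. \<Sum>b\<in>V. \<Sum>c\<in>V. ?e a b * ?e a c)"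
    unfolding outdegree_def by (simp add: sum_product power2_eq_square)
  also have "\<dots> = (\<Sum>a\<in>V. \<Sum>b\<in>V. \<Sum>c\<in>V.
      ?e a b * ?e b c * ?e a c + ?e a c * ?e c b * ?e a b + (if b = c then ?e a b else 0))"
  proof (intro sum.cong refl)
    fix a b c assume "a \<in> V" "b \<in> V" "c \<in> V"
    then have "?e b c + ?e c b = (if b = c then 0 else 1)" "?e a b * ?e a b = ?e a b"
      using edge_ind_add[OF assms(2)] by (auto simp: edge_ind_def)
    moreover have "?e a b * ?e b c * ?e a c + ?e a c * ?e c b * ?e a b = ?e a b * ?e a c * (?e b c + ?e c b)"
      by (simp add: algebra_simps)
    ultimately show "?e a b * ?e a c =
        ?e a b * ?e b c * ?e a c + ?e a c * ?e c b * ?e a b + (if b = c then ?e a b else 0)"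
      by auto
  qed
  also have "\<dots> = T + (\<Sum>a\<in>V. \<Sum>b\<in>V. \<Sum>c\<in>V. ?e a c * ?e c b * ?e a b) + (\<Sum>v\<in>V. outdegree V E v)"
    unfolding T_def outdegree_def using assms(1) by (simp add: sum.distrib)
  also have "(\<Sum>a\<in>V. \<Sum>b\<in>V. \<Sum>c\<in>V. ?e a c * ?e c b * ?e a b) = T"
    unfolding T_def by (rule sum.cong[OF refl]) (rule sum.swap)
  finally show ?thesis
    using paths by (simp add: sum.distrib sum_subtractf mult.assoc flip: sum_distrib_left)
qed

text \<open>Outdegree and indegree are half of \<open>n - 1\<close> plus or minus the excess.
  Substituting them leaves a term linear in the excess, which disappears because the excesses sum to
  0.\<close>

theorem cyclic_triples_excess:
  assumes "finite V" "tournament_on V E"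
  defines "n \<equiv> int (card V)"
  shows "8 * int (card (cyclic_triples E)) = n * (n\<^sup>2 - 1) - 3 * (\<Sum>v\<in>V. (excess V E v)\<^sup>2)"
proof -
  have "8 * int (card (cyclic_triples E)) = (\<Sum>v\<in>V. 4 * (2 * outdegree V E v * indegree V E v
      - (outdegree V E v)\<^sup>2 + outdegree V E v))"
    using cyclic_triples_outdegree[OF assms(1,2)] by (simp only: sum_distrib_left[symmetric])
  also have "\<dots> = (\<Sum>v\<in>V. (n\<^sup>2 - 1) - 3 * (excess V E v)\<^sup>2 - 2 * (n - 2) * excess V E v)"
  proof (intro sum.cong refl)
    fix v assume "v \<in> V"
    then have indeg: "indegree V E v = n - 1 - outdegree V E v"
      using outdegree_add_indegree[OF assms(1,2), of v] unfolding n_def by simp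
    show "4 * (2 * outdegree V E v * indegree V E v - (outdegree V E v)\<^sup>2 + outdegree V E v) =
        (n\<^sup>2 - 1) - 3 * (excess V E v)\<^sup>2 - 2 * (n - 2) * excess V E v"
      unfolding excess_eq indeg by (simp add: power2_eq_square algebra_simps)
  qed
  also have "\<dots> = n * (n\<^sup>2 - 1) - 3 * (\<Sum>v\<in>V. (excess V E v)\<^sup>2) - 2 * (n - 2) * (\<Sum>v\<in>V. excess V E v)"
    by (simp add: sum_subtractf sum_distrib_left n_def)
  also have "(\<Sum>v\<in>V. excess V E v) = 0"
    unfolding excess_eq by (simp add: sum_subtractf sum_outdegree_eq_indegree)
  finally show ?thesis by simp
qed

text \<open>Each triangle has weight 1/8, which cancels the 8 of Beck's criterion with
  \<open>\<Delta> = 1\<close>.\<close>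

lemma card_directed_triangles_le_of_breaker_wins:
  assumes "finite E" "breaker_wins_triangle_game E"
  shows "card (directed_triangles E) \<le> card E"
proof -
  obtain \<sigma> where "breaker_winning_strategy E (directed_triangles E) \<sigma>"
    using assms(2) unfolding breaker_wins_triangle_game_def by blast
  then have "(\<Sum>A\<in>directed_triangles E. (1/2) ^ card A) \<le> real 1 * real (card E) / 8"
    by (intro beck_maker_criterion[OF assms(1) directed_triangles_subset]
        card_directed_triangles_two_edges)
  moreover have "(\<Sum>A\<in>directed_triangles E. (1/2 :: real) ^ card A) = (\<Sum>A\<in>directed_triangles E. 1/8)"
    by (intro sum.cong refl) (simp add: card_directed_triangle power3_eq_cube)
  ultimately show ?thesis by simp
qed

text \<open>A win for Breaker forces few triangles, hence an irregular tournament; the flips have to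
  create this irregularity.\<close>

lemma sum_excess_square_ge_of_breaker_wins:
  assumes "finite V" "tournament_on V E" "breaker_wins_triangle_game E"
  defines "n \<equiv> int (card V)"
  shows "n * (n\<^sup>2 - 1) - 12 * (n * (n - 1)) \<le> 3 * (\<Sum>v\<in>V. (excess V E v)\<^sup>2)"
proof -
  have "E \<subseteq> V \<times> V" using assms(2) unfolding tournament_on_def by blast
  then have "finite E" using assms(1) finite_subset by blast
  have asym: "(j, i) \<notin> E" if "(i, j) \<in> E" for i j
  proof -
    have "i \<in> V" "j \<in> V" using that \<open>E \<subseteq> V \<times> V\<close> by auto
    then show ?thesis using that assms(2) unfolding tournament_on_def by metis
  qed
  have "card (cyclic_triples E) \<le> 3 * card E"
    using card_cyclic_triples_le[OF \<open>finite E\<close> asym]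
      card_directed_triangles_le_of_breaker_wins[OF \<open>finite E\<close> assms(3)]
    by linarith
  then have "8 * int (card (cyclic_triples E)) \<le> 12 * (2 * int (card E))" by linarith
  then show ?thesis
    unfolding cyclic_triples_excess[OF assms(1,2)] twice_card_tournament[OF assms(1,2)] n_def
    by linarith
qed

section \<open>The flip-bias threshold\<close>

lemma abs_excess_le:
  assumes "finite V" "tournament_on V E" "v \<in> V"
  shows "\<bar>excess V E v\<bar> \<le> int (card V) - 1"
proof -
  have "outdegree V E v \<ge> 0" "indegree V E v \<ge> 0"
    unfolding outdegree_def indegree_def edge_ind_def by (simp_all add: sum_nonneg)
  then show ?thesis
    using outdegree_add_indegree[OF assms] unfolding excess_eq by linarith
qed

text \<open>A summand of the excess changes only if its pair is flipped, and then by at most 2;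
  distinct \<open>j\<close> give distinct pairs \<open>{v, j}\<close>.\<close>

lemma abs_excess_flip_le:
  assumes "finite V" "finite S"
  shows "\<bar>excess V (flip E S) v - excess V E v\<bar> \<le> 2 * int (card {p \<in> S. v \<in> p})"
proof -
  let ?d = "\<lambda>E j. edge_ind E v j - edge_ind E j v"
  have "\<bar>excess V (flip E S) v - excess V E v\<bar> = \<bar>\<Sum>j\<in>V. ?d (flip E S) j - ?d E j\<bar>"
    unfolding excess_def by (simp add: sum_subtractf)
  also have "\<dots> \<le> (\<Sum>j\<in>V. \<bar>?d (flip E S) j - ?d E j\<bar>)"
    by (rule sum_abs)
  also have "\<dots> \<le> (\<Sum>j\<in>V. if {v, j} \<in> S then 2 else 0)"
    by (intro sum_mono) (auto simp: edge_ind_def mem_flip_iff insert_commute)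
  also have "\<dots> = 2 * int (card {j \<in> V. {v, j} \<in> S})"
    using assms(1) by (simp add: sum.inter_filter[symmetric])
  also have "card {j \<in> V. {v, j} \<in> S} \<le> card {p \<in> S. v \<in> p}"
    using assms(2) by (intro card_inj_on_le[where f = "\<lambda>j. {v, j}"]) (auto simp: inj_on_def doubleton_eq_iff)
  finally show ?thesis by simp
qed

text \<open>Incidences between points and sets are counted in two ways; \<open>k = 2\<close> is the
  handshake identity for flipped pairs.\<close>

lemma sum_card_containing:
  assumes "finite V" "S \<subseteq> Pow V" "\<And>p. p \<in> S \<Longrightarrow> card p = k"
  shows "(\<Sum>v\<in>V. card {p \<in> S. v \<in> p}) = k * card S"
proof -
  have "finite S" using assms(1,2) by (meson finite_Pow_iff finite_subset)
  then have "(\<Sum>v\<in>V. card {p \<in> S. v \<in> p}) = (\<Sum>v\<in>V. \<Sum>p\<in>S. if v \<in> p then 1 else 0)"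
    by (simp add: sum.inter_filter[symmetric])
  also have "\<dots> = (\<Sum>p\<in>S. \<Sum>v\<in>V. if v \<in> p then 1 else 0)"
    by (rule sum.swap)
  also have "\<dots> = (\<Sum>p\<in>S. card (V \<inter> p))"
    using assms(1) by (simp add: sum.inter_restrict[symmetric])
  also have "\<dots> = (\<Sum>p\<in>S. k)"
    using assms(2,3) by (intro sum.cong refl) (metis Int_absorb1 PowD subsetD)
  finally show ?thesis by (simp add: mult.commute)
qed

text \<open>Omitting \<open>j = v\<close>, the signs alternate along \<open>1..n\<close>, even
  across the gap, since the rule reverses at \<open>v\<close>. So \<open>n - 1\<close> alternating
  signs are added, the first being + exactly for odd \<open>v\<close>. The case
  \<open>n < v\<close>, where nothing is omitted yet, is included to let the induction on
  \<open>n\<close> run.\<close>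

lemma sum_alternating_signs:
  fixes n v :: nat
  assumes "v \<ge> 1"
  shows "(\<Sum>j=1..n. if j = v then 0 else if (v < j) = odd (v + j) then 1 else - 1 :: int) =
    (if n < v then (if even n then 0 else if odd v then 1 else - 1)
     else (if odd n then 0 else if odd v then 1 else - 1))"
    (is "sum ?g _ = ?F n")
proof (induction n)
  case 0
  then show ?case using assms by simp
next
  case (Suc n)
  have "?F n + ?g (Suc n) = ?F (Suc n)"
  proof (cases "Suc n" v rule: linorder_cases)
    case less
    then show ?thesis by auto
  next
    case equal
    then show ?thesis by auto
  next
    case greater
    then show ?thesis by auto
  qed
  moreover have "sum ?g {1..Suc n} = sum ?g {1..n} + ?g (Suc n)"
    by (subst sum.cl_ivl_Suc) simp
  ultimately show ?case using Suc.IH by (simp only:)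
qed

lemma excess_parity_tournament:
  assumes "v \<in> {1..n}"
  shows "excess {1..n} (parity_tournament n) v = (if odd n then 0 else if odd v then 1 else - 1)"
proof -
  have "excess {1..n} (parity_tournament n) v =
      (\<Sum>j=1..n. if j = v then 0 else if (v < j) = odd (v + j) then 1 else - 1)"
    unfolding excess_def
  proof (intro sum.cong refl)
    fix j assume "j \<in> {1..n}"
    with assms show "edge_ind (parity_tournament n) v j - edge_ind (parity_tournament n) j v =
        (if j = v then 0 else if (v < j) = odd (v + j) then 1 else - 1)"
      unfolding edge_ind_def mem_parity_tournament_iff
      by (cases v j rule: linorder_cases) simp_all
  qed
  then show ?thesis
    using sum_alternating_signs[of v n] assms by simp
qed

lemma vertex_pairs_subset: "vertex_pairs n \<subseteq> Pow {1..n}"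
  unfolding vertex_pairs_def by auto

lemma card_vertex_pair: "p \<in> vertex_pairs n \<Longrightarrow> card p = 2"
  unfolding vertex_pairs_def by auto

lemma flip_bias_threshold_witness:
  obtains S where "S \<subseteq> vertex_pairs n" "card S \<le> flip_bias_threshold n"
    "breaker_wins_triangle_game (flip (parity_tournament n) S)"
  using LeastI_ex[OF flip_bias_threshold_exists[of n]] unfolding flip_bias_threshold_def by blast

lemma flip_bias_threshold_le:
  assumes "S \<subseteq> vertex_pairs n" "card S \<le> k"
    "breaker_wins_triangle_game (flip (parity_tournament n) S)"
  shows "flip_bias_threshold n \<le> k"
  unfolding flip_bias_threshold_def by (rule Least_le) (use assms in blast)

text \<open>Each squared excess is bounded by the product of two estimates, one linear in the number
  \<open>f v\<close> of flips at \<open>v\<close> and one of order \<open>n\<close>. The sum of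
  squares is then linear in the number of flips.\<close>

lemma flip_bias_threshold_lower:
  assumes "n \<ge> 2"
  shows "odd n \<Longrightarrow> int n * (int n - 11) \<le> 12 * int (flip_bias_threshold n)" (is "_ \<Longrightarrow> ?odd")
    and "even n \<Longrightarrow> (int n)\<^sup>2 - 12 * int n + 8 \<le> 12 * int (flip_bias_threshold n)" (is "_ \<Longrightarrow> ?even")
proof -
  obtain S where S: "S \<subseteq> vertex_pairs n" "card S \<le> flip_bias_threshold n"
    and wins: "breaker_wins_triangle_game (flip (parity_tournament n) S)"
    by (rule flip_bias_threshold_witness)
  define E where "E = flip (parity_tournament n) S"
  define D where "D v = excess {1..n} E v" for v
  define f where "f v = int (card {p \<in> S. v \<in> p})" for v
  define N where "N = int n"
  have finS: "finite S"
    using S(1) vertex_pairs_subset[of n] by (meson finite_Pow_iff finite_atLeastAtMost finite_subset)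
  have E: "tournament_on {1..n} E"
    unfolding E_def by (intro tournament_on_flip tournament_on_parity_tournament)
  have "(\<Sum>v=1..n. card {p \<in> S. v \<in> p}) = 2 * card S"
    using S(1) vertex_pairs_subset card_vertex_pair by (intro sum_card_containing) blast+
  then have "int (\<Sum>v=1..n. card {p \<in> S. v \<in> p}) \<le> 2 * int (flip_bias_threshold n)"
    using S(2) by linarith
  then have sum_f: "(\<Sum>v=1..n. f v) \<le> 2 * int (flip_bias_threshold n)"
    unfolding f_def by simp
  have main: "N * (N\<^sup>2 - 1) - 12 * (N * (N - 1)) \<le> 3 * (\<Sum>v=1..n. (D v)\<^sup>2)"
    using sum_excess_square_ge_of_breaker_wins[OF _ E] wins unfolding D_def N_def E_def by simp
  have D_le: "\<bar>D v\<bar> \<le> N - 1" if "v \<in> {1..n}" for v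
    using abs_excess_le[OF _ E that] unfolding D_def N_def by simp
  have D_flip: "\<bar>D v - (if odd n then 0 else if odd v then 1 else - 1)\<bar> \<le> 2 * f v"
    if "v \<in> {1..n}" for v
    using abs_excess_flip_le[of "{1..n}" S "parity_tournament n" v] finS
      excess_parity_tournament[OF that]
    unfolding D_def E_def f_def by simp
  have N: "N \<ge> 2" using assms unfolding N_def by simp
  show ?odd if "odd n"
  proof -
    have "(D v)\<^sup>2 \<le> 2 * (N - 1) * f v" if "v \<in> {1..n}" for v
    proof -
      have "\<bar>D v\<bar> * \<bar>D v\<bar> \<le> (N - 1) * (2 * f v)"
        using D_le[OF that] D_flip[OF that] \<open>odd n\<close> N by (intro mult_mono) auto
      then show ?thesis by (simp add: power2_eq_square algebra_simps)
    qed
    then have "(\<Sum>v=1..n. (D v)\<^sup>2) \<le> 2 * (N - 1) * (\<Sum>v=1..n. f v)"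
      unfolding sum_distrib_left by (intro sum_mono)
    also have "\<dots> \<le> 2 * (N - 1) * (2 * int (flip_bias_threshold n))"
      using sum_f N by (intro mult_left_mono) auto
    \<comment> \<open>The left side of \<open>main\<close> factors as
      \<open>N * (N - 1) * (N - 11)\<close>; the common factor \<open>N - 1\<close> is
      positive.\<close>
    finally have "(N - 1) * (N * (N - 11)) \<le> (N - 1) * (12 * int (flip_bias_threshold n))"
      using main by (simp add: power2_eq_square algebra_simps)
    then show ?thesis using N unfolding N_def[symmetric] by simp
  qed
  show ?even if "even n"
  proof -
    have "(D v)\<^sup>2 \<le> 1 + 2 * N * f v" if "v \<in> {1..n}" for v
    proof -
      have "f v \<ge> 0" unfolding f_def by simp
      have "\<bar>D v\<bar> - 1 \<le> 2 * f v"
        using D_flip[OF that] by (auto split: if_splits)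
      \<comment> \<open>The excess starts at 1 or -1, so the flips control
        \<open>\<bar>D v\<bar> - 1\<close>; the cofactor \<open>\<bar>D v\<bar> + 1\<close> is at
        most \<open>N\<close>.\<close>
      then have "(\<bar>D v\<bar> - 1) * (\<bar>D v\<bar> + 1) \<le> 2 * f v * (\<bar>D v\<bar> + 1)"
        by (intro mult_right_mono) auto
      also have "\<dots> \<le> 2 * f v * N"
        using D_le[OF that] \<open>f v \<ge> 0\<close> by (intro mult_left_mono) auto
      finally show ?thesis by (simp add: power2_eq_square algebra_simps)
    qed
    then have "(\<Sum>v=1..n. (D v)\<^sup>2) \<le> (\<Sum>v=1..n. 1 + 2 * N * f v)"
      by (intro sum_mono)
    also have "\<dots> = N + 2 * N * (\<Sum>v=1..n. f v)"
      by (simp add: sum.distrib sum_distrib_left N_def)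
    also have "\<dots> \<le> N + 2 * N * (2 * int (flip_bias_threshold n))"
      using sum_f N by (intro add_left_mono mult_left_mono) auto
    finally have "N * (N\<^sup>2 - 12 * N + 8) \<le> N * (12 * int (flip_bias_threshold n))"
      using main by (simp add: power2_eq_square algebra_simps)
    then show ?thesis using N unfolding N_def[symmetric] by simp
  qed
qed

section \<open>Upper bound from a transitive tournament\<close>

lemma breaker_wins_if_no_triangles:
  assumes "directed_triangles E = {}"
  shows "breaker_wins_triangle_game E"
proof -
  have "(SOME e. e \<in> E - set h) \<in> E - set h" if "legal_play E h" "set h \<noteq> E" for h
    by (rule someI_ex) (use that in \<open>auto simp: legal_play_def\<close>)
  then have "breaker_winning_strategy E (directed_triangles E) (\<lambda>h. SOME e. e \<in> E - set h)"
    unfolding breaker_winning_strategy_def assms by blast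
  then show ?thesis unfolding breaker_wins_triangle_game_def by blast
qed

definition even_odd_pairs :: "nat \<Rightarrow> nat set set" where
  "even_odd_pairs n = {{i, j} | i j. 1 \<le> i \<and> i < j \<and> j \<le> n \<and> even i \<and> odd j}"

lemma mem_even_odd_pairs_iff:
  "{i, j} \<in> even_odd_pairs n \<longleftrightarrow> i \<in> {1..n} \<and> j \<in> {1..n} \<and>
     (i < j \<and> even i \<and> odd j \<or> j < i \<and> even j \<and> odd i)"
  unfolding even_odd_pairs_def by (auto simp: doubleton_eq_iff)

text \<open>Writing the pair as \<open>2 * a\<close> and \<open>2 * b + 1\<close> turns the order
  condition into \<open>1 \<le> a \<le> b\<close>, and \<open>(n - 1) div 2\<close> is the largest
  possible \<open>b\<close>. The bound is twice a triangular number.\<close>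

lemma card_even_odd_pairs:
  "2 * card (even_odd_pairs n) \<le> (n - 1) div 2 * ((n - 1) div 2 + 1)"
proof -
  define m where "m = (n - 1) div 2"
  let ?P = "SIGMA b:{1..m}. {1..b}"
  have "even_odd_pairs n \<subseteq> (\<lambda>(b, a). {2 * a, 2 * b + 1}) ` ?P"
  proof
    fix p assume "p \<in> even_odd_pairs n"
    then obtain i j where "p = {i, j}" "1 \<le> i" "i < j" "j \<le> n" "even i" "odd j"
      unfolding even_odd_pairs_def by blast
    moreover from \<open>even i\<close> obtain a where "i = 2 * a" by blast
    moreover from \<open>odd j\<close> obtain b where "j = 2 * b + 1" by (rule oddE)
    ultimately have "p = {2 * a, 2 * b + 1}" "(b, a) \<in> ?P"
      unfolding m_def by auto
    then show "p \<in> (\<lambda>(b, a). {2 * a, 2 * b + 1}) ` ?P" by force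
  qed
  then have "card (even_odd_pairs n) \<le> card ?P"
    by (intro surj_card_le) auto
  also have "card ?P = \<Sum>{1..m}" by simp
  also have "2 * \<dots> = m * (m + 1)"
    by (induction m) auto
  finally show ?thesis unfolding m_def by simp
qed

lemma directed_triangles_flip_even_odd_pairs:
  "directed_triangles (flip (parity_tournament n) (even_odd_pairs n)) = {}"
proof -
  \<comment> \<open>A rank placing every odd vertex above all even ones, with the usual order within
    each class; every edge strictly lowers it, so no cycle closes.\<close>
  define r where "r i = (if odd i then i + n else i)" for i :: nat
  have "r j < r i" if "(i, j) \<in> flip (parity_tournament n) (even_odd_pairs n)" for i j
    using that unfolding mem_flip_iff mem_even_odd_pairs_iff mem_parity_tournament_iff r_def
    by (auto split: if_splits)
  then show ?thesis
    unfolding directed_triangles_def by (blast dest: less_trans less_asym)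
qed

lemma flip_bias_threshold_upper:
  "2 * flip_bias_threshold n \<le> (n - 1) div 2 * ((n - 1) div 2 + 1)"
proof -
  have "even_odd_pairs n \<subseteq> vertex_pairs n"
    unfolding even_odd_pairs_def vertex_pairs_def by blast
  then have "flip_bias_threshold n \<le> card (even_odd_pairs n)"
    by (intro flip_bias_threshold_le[OF _ order_refl] breaker_wins_if_no_triangles
        directed_triangles_flip_even_odd_pairs)
  then show ?thesis using card_even_odd_pairs[of n] by linarith
qed

theorem theorem2p4:
  fixes n :: nat
  assumes "n \<ge> 1"
  shows "(odd n \<longrightarrow> real (flip_bias_threshold n) \<le> ((real n)\<^sup>2 - 1) / 8) \<and>
         (even n \<longrightarrow> real (flip_bias_threshold n) \<le> (real n)\<^sup>2 / 8 + real n / 4 - 1) \<and>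
         (odd n \<and> n \<ge> 11 \<longrightarrow> real (flip_bias_threshold n) \<ge> real n * (real n - 11) / 12) \<and>
         (even n \<and> n \<ge> 14 \<longrightarrow> real (flip_bias_threshold n) \<ge> real n * (real n - 14) / 12 + 1)"
proof (intro conjI impI; (elim conjE)?)
  define m where "m = (n - 1) div 2"
  have "real (2 * flip_bias_threshold n) \<le> real (m * (m + 1))"
    using flip_bias_threshold_upper[of n] unfolding m_def of_nat_le_iff .
  then have upper: "2 * real (flip_bias_threshold n) \<le> real m * (real m + 1)"
    by (simp add: algebra_simps)
  show "real (flip_bias_threshold n) \<le> ((real n)\<^sup>2 - 1) / 8" if "odd n"
  proof -
    have "n = 2 * m + 1" using that unfolding m_def by (auto elim: oddE)
    then show ?thesis using upper by (simp add: power2_eq_square field_simps)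
  qed
  show "real (flip_bias_threshold n) \<le> (real n)\<^sup>2 / 8 + real n / 4 - 1" if "even n"
  proof -
    \<comment> \<open>Here \<open>m * (m + 1) / 2\<close> equals
      \<open>n\<^sup>2 / 8 - n / 4\<close>, which is at most the claimed bound because
      \<open>n \<ge> 2\<close>.\<close>
    have "n = 2 * m + 2" using that assms unfolding m_def by (auto elim!: evenE)
    then show ?thesis using upper by (simp add: power2_eq_square field_simps)
  qed
  show "real (flip_bias_threshold n) \<ge> real n * (real n - 11) / 12" if "odd n" "n \<ge> 11"
  proof -
    have "real_of_int (int n * (int n - 11)) \<le> real_of_int (12 * int (flip_bias_threshold n))"
      using flip_bias_threshold_lower(1)[of n] that unfolding of_int_le_iff by simp
    then show ?thesis by simp
  qed
  show "real (flip_bias_threshold n) \<ge> real n * (real n - 14) / 12 + 1" if "even n" "n \<ge> 14"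
  proof -
    have "real_of_int ((int n)\<^sup>2 - 12 * int n + 8) \<le> real_of_int (12 * int (flip_bias_threshold n))"
      using flip_bias_threshold_lower(2)[of n] that unfolding of_int_le_iff by simp
    \<comment> \<open>The claim amounts to
      \<open>n\<^sup>2 - 14 * n + 12 \<le> 12 * flip_bias_threshold n\<close>; its left side is
      smaller than the one obtained by \<open>2 * n - 4\<close>.\<close>
    then show ?thesis using that by (simp add: power2_eq_square field_simps)
  qed
qed

end
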